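(* Let $d\ge 0$ be an integer. In a combinatorial auction with $n$ bidders and item set $[m]$, if every bidder's valuation belongs to $\max(\mathrm{SMW}\text{-}d\cap\mathrm{SUPADD})$, then the Simultaneous Item First Price Auction has a price of anarchy with respect to coarse correlated equilibria of at most $2(d+1)^2\cdot H_{m/(d+1)}$.
   Context: Valuations are normalized ($f(\emptyset)=0$) monotone set functions $f:2^{[m]}\to\mathbb{R}_{\ge0}$. Write $f(S\mid T)=f(S\cup T)-f(T)$, $f(v\mid T)=f(\{v\}\mid T)$. A set $T$ is supermodular w.r.t. $f$ if there exist $S\subseteq[m]$ and $v\in[m]\setminus T$ with $f(v\mid S\cup T)>\max_{T'\subsetneq T} f(v\mid S\cup T')$; $\mathrm{SMW}(f)$ is the maximum cardinality of a nonempty supermodular set (0 if none), and $\mathrm{SMW}\text{-}d$ is the class of $f$ with $\mathrm{SMW}(f)\le d$. $\mathrm{SUPADD}$ is the class of monotone superadditive set functions ($f(S\cup T)\ge f(S)+f(T)$ for disjoint $S,T$). For a class $\mathcal{F}$, $\max(\mathcal{F})$ is the class of functions $f(S)=\max_{i\in[k]} f_i(S)$ with $f_1,\dots,f_k\in\mathcal{F}$. Simultaneous Item First Price Auction: each bidder bids on every item; each item goes to its highest bidder, who pays its bid on that item. Utilities are quasilinear; social welfare is the sum of bidders' values. The price of anarchy w.r.t. coarse correlated equilibria is the supremum over valuation profiles in the class and over coarse correlated equilibria of optimal welfare divided by expected equilibrium welfare. $H_x=\sum_{k\in[x]}1/k$, where $[x]=\{k\in\mathbb{Z}:1\le k\le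 x\}$.
   Formalization: The formal theorem assumes d < m: for m ≤ d the sum H_{m/(d+1)} is empty, so the stated bound would be 0, which fails already for one bidder, one item of value 1 and d = 1 (price of anarchy 1). *)

theory Defs
  imports "HOL-Probability.Probability"
begin

text \<open>
  Items are \<open>{1..m}\<close> and bidders are \<open>{1..n}\<close>. A set function on \<open>2\<^bsup>[m]\<^esup>\<close> is a
  function \<open>f :: nat set \<Rightarrow> real\<close> of which only the values on subsets of \<open>{1..m}\<close> matter.
\<close>

section \<open>Set functions\<close>

definition monotone_setfun :: "nat \<Rightarrow> (nat set \<Rightarrow> real) \<Rightarrow> bool" where
  "monotone_setfun m f \<longleftrightarrow> (\<forall>S T. S \<subseteq> T \<and> T \<subseteq> {1..m} \<longrightarrow> f S \<le> f T)"

definition valuation :: "nat \<Rightarrow> (nat set \<Rightarrow> real) \<Rightarrow> bool" where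
  "valuation m f \<longleftrightarrow>
     f {} = 0 \<and> (\<forall>S. S \<subseteq> {1..m} \<longrightarrow> 0 \<le> f S) \<and> monotone_setfun m f"

definition marginal :: "(nat set \<Rightarrow> real) \<Rightarrow> nat set \<Rightarrow> nat set \<Rightarrow> real" where
  "marginal f S T = f (S \<union> T) - f T"

text \<open>For \<open>T = {}\<close> the maximum below ranges over the empty set and is unspecified;
  the predicate is only used for nonempty \<open>T\<close>.\<close>

definition supermodular_set :: "nat \<Rightarrow> (nat set \<Rightarrow> real) \<Rightarrow> nat set \<Rightarrow> bool" where
  "supermodular_set m f T \<longleftrightarrow> T \<subseteq> {1..m} \<and>
     (\<exists>S v. S \<subseteq> {1..m} \<and> v \<in> {1..m} - T \<and>
        marginal f {v} (S \<union> T) > Max ((\<lambda>T'. marginal f {v} (S \<union> T')) ` {T'. T' \<subset> T}))"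

definition SMW :: "nat \<Rightarrow> (nat set \<Rightarrow> real) \<Rightarrow> nat" where
  "SMW m f =
     (if \<exists>T. T \<noteq> {} \<and> supermodular_set m f T
      then Max (card ` {T. T \<noteq> {} \<and> supermodular_set m f T}) else 0)"

definition SMW_class :: "nat \<Rightarrow> nat \<Rightarrow> (nat set \<Rightarrow> real) set" where
  "SMW_class m d = {f. valuation m f \<and> SMW m f \<le> d}"

definition SUPADD :: "nat \<Rightarrow> (nat set \<Rightarrow> real) set" where
  "SUPADD m = {f. monotone_setfun m f \<and>
     (\<forall>S T. S \<subseteq> {1..m} \<and> T \<subseteq> {1..m} \<and> S \<inter> T = {} \<longrightarrow> f (S \<union> T) \<ge> f S + f T)}"

definition max_class :: "nat \<Rightarrow> (nat set \<Rightarrow> real) set \<Rightarrow> (nat set \<Rightarrow> real) set" where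
  "max_class m \<F> = {f. \<exists>(k::nat) g. 1 \<le> k \<and> (\<forall>i\<in>{1..k}. g i \<in> \<F>) \<and>
     (\<forall>S. S \<subseteq> {1..m} \<longrightarrow> f S = Max ((\<lambda>i. g i S) ` {1..k}))}"

section \<open>The simultaneous item first price auction\<close>

text \<open>\<open>b i j\<close> is the nonnegative bid of bidder \<open>i\<close> on item \<open>j\<close>.\<close>

definition bid_space :: "nat \<Rightarrow> (nat \<Rightarrow> real) measure" where
  "bid_space m = Pi\<^sub>M {1..m} (\<lambda>_. restrict_space borel {0..})"

definition profile_space :: "nat \<Rightarrow> nat \<Rightarrow> (nat \<Rightarrow> nat \<Rightarrow> real) measure" where
  "profile_space n m = Pi\<^sub>M {1..n} (\<lambda>_. bid_space m)"

definition highest_bidders :: "nat \<Rightarrow> (nat \<Rightarrow> nat \<Rightarrow> real) \<Rightarrow> nat \<Rightarrow> nat set" where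
  "highest_bidders n b j = {i\<in>{1..n}. \<forall>i'\<in>{1..n}. b i' j \<le> b i j}"

text \<open>
  A possibly randomized allocation rule: \<open>A b\<close> is the distribution of the map sending each
  item to its winner, and the winner is always a highest bidder. Ties may be broken in any
  way (measurably in \<open>b\<close>, so that expected utilities make sense); deterministic rules are
  those where \<open>A b\<close> is a point mass.
\<close>

definition first_price_rule ::
    "nat \<Rightarrow> nat \<Rightarrow> ((nat \<Rightarrow> nat \<Rightarrow> real) \<Rightarrow> (nat \<Rightarrow> nat) pmf) \<Rightarrow> bool" where
  "first_price_rule n m A \<longleftrightarrow>
     (\<forall>b\<in>space (profile_space n m).
        set_pmf (A b) \<subseteq> (\<Pi>\<^sub>E j\<in>{1..m}. highest_bidders n b j)) \<and>
     (\<forall>w. (\<lambda>b. pmf (A b) w) \<in> borel_measurable (profile_space n m))"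

definition won :: "nat \<Rightarrow> (nat \<Rightarrow> nat) \<Rightarrow> nat \<Rightarrow> nat set" where
  "won m w i = {j\<in>{1..m}. w j = i}"

definition utility ::
    "nat \<Rightarrow> ((nat \<Rightarrow> nat \<Rightarrow> real) \<Rightarrow> (nat \<Rightarrow> nat) pmf) \<Rightarrow> (nat \<Rightarrow> nat set \<Rightarrow> real)
      \<Rightarrow> nat \<Rightarrow> (nat \<Rightarrow> nat \<Rightarrow> real) \<Rightarrow> real" where
  "utility m A v i b =
     measure_pmf.expectation (A b) (\<lambda>w. v i (won m w i) - (\<Sum>j\<in>won m w i. b i j))"

definition welfare ::
    "nat \<Rightarrow> nat \<Rightarrow> ((nat \<Rightarrow> nat \<Rightarrow> real) \<Rightarrow> (nat \<Rightarrow> nat) pmf) \<Rightarrow> (nat \<Rightarrow> nat set \<Rightarrow> real)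
      \<Rightarrow> (nat \<Rightarrow> nat \<Rightarrow> real) \<Rightarrow> real" where
  "welfare n m A v b =
     measure_pmf.expectation (A b) (\<lambda>w. \<Sum>i\<in>{1..n}. v i (won m w i))"

definition opt_welfare :: "nat \<Rightarrow> nat \<Rightarrow> (nat \<Rightarrow> nat set \<Rightarrow> real) \<Rightarrow> real" where
  "opt_welfare n m v =
     Max ((\<lambda>X. \<Sum>i\<in>{1..n}. v i (X i)) `
       {X \<in> {1..n} \<rightarrow>\<^sub>E Pow {1..m}. disjoint_family_on X {1..n}})"

text \<open>
  Equilibria are arbitrary (not necessarily discrete) Borel probability distributions over
  bid profiles. Utilities are bounded above, so a bidder whose utility is not integrable has
  expected utility \<open>-\<infinity>\<close> and would rather bid 0; requiring integrability excludes nothing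
  and only keeps the Bochner integral from defaulting to 0. After a fixed deviation the
  utility is bounded and hence integrable.
\<close>

definition coarse_correlated_equilibria ::
    "nat \<Rightarrow> nat \<Rightarrow> ((nat \<Rightarrow> nat \<Rightarrow> real) \<Rightarrow> (nat \<Rightarrow> nat) pmf) \<Rightarrow> (nat \<Rightarrow> nat set \<Rightarrow> real)
      \<Rightarrow> (nat \<Rightarrow> nat \<Rightarrow> real) measure set" where
  "coarse_correlated_equilibria n m A v =
     {M. prob_space M \<and> sets M = sets (profile_space n m) \<and>
         (\<forall>i\<in>{1..n}. integrable M (utility m A v i) \<and>
            (\<forall>b'\<in>space (bid_space m).
               (\<integral>b. utility m A v i (b(i := b')) \<partial>M) \<le> (\<integral>b. utility m A v i b \<partial>M)))}"

text \<open>
  In \<^typ>\<open>ennreal\<close>, \<open>c / 0 = \<infinity>\<close> for \<open>c > 0\<close>, while \<open>0 / 0 = 0\<close>, so that profiles with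
  zero optimal welfare do not contribute to the supremum.
\<close>

definition price_of_anarchy_CCE ::
    "nat \<Rightarrow> nat \<Rightarrow> ((nat \<Rightarrow> nat \<Rightarrow> real) \<Rightarrow> (nat \<Rightarrow> nat) pmf) \<Rightarrow> (nat set \<Rightarrow> real) set
      \<Rightarrow> ennreal" where
  "price_of_anarchy_CCE n m A \<F> =
     Sup {ennreal (opt_welfare n m v) / ennreal (\<integral>b. welfare n m A v b \<partial>M) | v M.
            (\<forall>i\<in>{1..n}. v i \<in> \<F>) \<and> M \<in> coarse_correlated_equilibria n m A v}"

definition H :: "real \<Rightarrow> real" where
  "H x = (\<Sum>k\<in>{k::int. 1 \<le> k \<and> real_of_int k \<le> x}. 1 / real_of_int k)"

end

theory Submission imports Defs begin

text \<open>
  Put \<open>k = d + 1\<close>. Let \<open>f\<close> be superadditive with \<open>SMW f \<le> d\<close>. A marginal of \<open>f\<close> is at most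
  the value of some set of at most \<open>k\<close> items, so greedily cutting a set \<open>S\<close> into disjoint blocks
  of size at most \<open>k\<close> yields total block value at least \<open>f S / k\<close>; by superadditivity \<open>f\<close>
  dominates the function that adds up the values of the blocks fully contained in its argument.

  A bidder aiming at its optimal bundle bids, on all items of a block of value \<open>q\<close>, one price
  drawn uniformly from \<open>[0, q / k]\<close>. Against top bids \<open>p\<close> this earns at least
  \<open>q / 2 - k * (\<Sum>j\<in>Q. p j)\<close> on the block \<open>Q\<close>. Summing over blocks and bidders, the equilibrium
  condition gives \<open>W - Rev \<ge> Opt / (2 * k) - k * Rev\<close>, and \<open>Rev \<le> W\<close> because bidding zero
  guarantees a nonnegative utility. Hence \<open>Opt \<le> 2 * k\<^sup>2 * W\<close>, which is stronger than the claim
  since the harmonic factor is at least 1.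
\<close>

section \<open>Supermodular sets, marginals and block packings\<close>

text \<open>A set with more than \<open>d\<close> elements is not supermodular, so some proper
  subset gives \<open>v\<close> a marginal at least as large. Repeating this descent stops only at a
  set of size at most \<open>d\<close>.\<close>

lemma marginal_le_small_support:
  assumes "SMW m f \<le> d" "T \<subseteq> {1..m}" "v \<in> {1..m} - T"
  obtains T' where "T' \<subseteq> T" "card T' \<le> d" "marginal f {v} T \<le> marginal f {v} T'"
proof -
  have "finite T" using assms(2) finite_subset by blast
  then have "\<exists>T'\<subseteq>T. card T' \<le> d \<and> marginal f {v} T \<le> marginal f {v} T'" using assms(2,3)
  proof (induction T rule: finite_psubset_induct)
    case (psubset T)
    show ?case
    proof (cases "card T \<le> d")
      case False
      then have ne: "T \<noteq> {}" by auto
      have fin: "finite {T. T \<noteq> {} \<and> supermodular_set m f T}"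
        by (rule finite_subset[of _ "Pow {1..m}"]) (auto simp: supermodular_set_def)
      have "\<not> supermodular_set m f T"
      proof
        assume sm: "supermodular_set m f T"
        then have "card T \<le> SMW m f"
          unfolding SMW_def using ne fin by (auto intro!: Max_ge)
        with False assms(1) show False by simp
      qed
      \<comment> \<open>The context set \<open>S\<close> in the definition of supermodularity is
        instantiated with \<open>{}\<close>. As \<open>T\<close> is nonempty, the maximum ranges
        over a nonempty family and is attained, which yields the proper subset to descend
        to.\<close>
      then have "\<not> Max ((\<lambda>T'. marginal f {v} ({} \<union> T')) ` {T'. T' \<subset> T}) < marginal f {v} ({} \<union> T)"
        unfolding supermodular_set_def using psubset.prems by blast
      moreover have "Max ((\<lambda>T'. marginal f {v} ({} \<union> T')) ` {T'. T' \<subset> T})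
          \<in> (\<lambda>T'. marginal f {v} ({} \<union> T')) ` {T'. T' \<subset> T}"
      proof (rule Max_in)
        have "finite {T'. T' \<subset> T}"
          by (rule finite_subset[of _ "Pow T"]) (use psubset.hyps in auto)
        then show "finite ((\<lambda>T'. marginal f {v} ({} \<union> T')) ` {T'. T' \<subset> T})" by simp
        have "{} \<in> {T'. T' \<subset> T}" using ne by auto
        then show "(\<lambda>T'. marginal f {v} ({} \<union> T')) ` {T'. T' \<subset> T} \<noteq> {}" by blast
      qed
      ultimately obtain T' where T': "T' \<subset> T" "marginal f {v} T \<le> marginal f {v} T'"
        unfolding image_iff not_less Un_empty_left by (metis mem_Collect_eq)
      then obtain T'' where "T'' \<subseteq> T'" "card T'' \<le> d" "marginal f {v} T' \<le> marginal f {v} T''"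
        using psubset.IH[of T'] psubset.prems by blast
      with T' show ?thesis by (meson order_trans psubset_imp_subset)
    qed auto
  qed
  then show ?thesis by (elim exE conjE) (rule that)
qed

text \<open>The items of \<open>U\<close> are added one by one. The marginal of \<open>v\<close> is
  at most its marginal over some \<open>T\<close> with at most \<open>d\<close> items, hence at most
  \<open>f (insert v T)\<close> because \<open>f T\<close> is nonnegative. The extra item
  \<open>v\<close> is why blocks have size \<open>d + 1\<close>.\<close>

lemma setfun_growth_le:
  assumes "valuation m f" "SMW m f \<le> d" "R \<union> U \<subseteq> {1..m}" "R \<inter> U = {}"
    and bound: "\<And>Q. Q \<subseteq> R \<union> U \<Longrightarrow> card Q \<le> d + 1 \<Longrightarrow> f Q \<le> M"
  shows "f (R \<union> U) \<le> f R + real (card U) * M"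
proof -
  have "finite U" using assms(3) finite_subset by blast
  then show ?thesis using assms(3-5)
  proof (induction U rule: finite_induct)
    case (insert v U)
    have IH: "f (R \<union> U) \<le> f R + real (card U) * M"
      using insert.prems by (intro insert.IH) auto
    have "v \<in> {1..m} - (R \<union> U)" using insert by auto
    then obtain T where T: "T \<subseteq> R \<union> U" "card T \<le> d" "marginal f {v} (R \<union> U) \<le> marginal f {v} T"
      using marginal_le_small_support[OF assms(2), of "R \<union> U" v] insert.prems(1) by auto
    have "T \<subseteq> {1..m}" using T(1) insert.prems(1) by blast
    then have "0 \<le> f T" using assms(1) unfolding valuation_def by blast
    then have "marginal f {v} T \<le> f (insert v T)" by (simp add: marginal_def)
    also have "\<dots> \<le> M"
    proof (rule insert.prems(3))
      have "finite T" using T(1) insert.prems(1) finite_subset[of T "{1..m}"] by blast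
      then show "card (insert v T) \<le> d + 1" using T(2) by (simp add: card_insert_if)
    qed (use T(1) in auto)
    finally have "f (R \<union> insert v U) - f (R \<union> U) \<le> M"
      using T(3) by (simp add: marginal_def)
    with IH insert.hyps show ?case by (simp add: algebra_simps)
  qed simp
qed

text \<open>The blocks are chosen greedily. Reinserting them in reverse order, each item of a block
  has marginal at most the value of that block, as the block was the best choice among the
  items present at that time.\<close>

lemma packing_exists:
  assumes "valuation m f" "SMW m f \<le> d" "S \<subseteq> {1..m}"
  obtains \<Q> where "disjoint \<Q>" "\<Union>\<Q> \<subseteq> S" "\<forall>Q\<in>\<Q>. card Q \<le> d + 1"
    "f S \<le> (real d + 1) * (\<Sum>Q\<in>\<Q>. f Q)"
proof -
  have "finite S" using assms(3) finite_subset by blast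
  then have "\<exists>\<Q>. disjoint \<Q> \<and> \<Union>\<Q> \<subseteq> S \<and> (\<forall>Q\<in>\<Q>. card Q \<le> d + 1) \<and>
      f S \<le> (real d + 1) * (\<Sum>Q\<in>\<Q>. f Q)" using assms(3)
  proof (induction S rule: finite_psubset_induct)
    case (psubset S)
    show ?case
    proof (cases "S = {}")
      case True
      then show ?thesis using assms(1) by (intro exI[of _ "{}"]) (auto simp: valuation_def)
    next
      case False
      then obtain x where x: "x \<in> S" by auto
      \<comment> \<open>Admitting only nonempty blocks makes \<open>S - Q\<close> strictly smaller,
        and keeps a new block distinct from all later ones.\<close>
      define C where "C = {Q. Q \<subseteq> S \<and> Q \<noteq> {} \<and> card Q \<le> d + 1}"
      have "finite C" unfolding C_def using psubset.hyps by simp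
      moreover have "{x} \<in> C" using x by (simp add: C_def)
      ultimately have "Max (f ` C) \<in> f ` C" by (intro Max_in) auto
      then obtain Q where Q: "Q \<in> C" "Max (f ` C) = f Q" by auto
      have max: "f Q' \<le> f Q" if "Q' \<in> C" for Q'
        unfolding Q(2)[symmetric] using that \<open>finite C\<close> by (intro Max_ge) auto
      have QS: "Q \<subseteq> S" "Q \<noteq> {}" "card Q \<le> d + 1" using Q(1) by (auto simp: C_def)
      have fQ: "0 \<le> f Q" using assms(1) QS psubset.prems by (auto simp: valuation_def)
      have "S - Q \<subset> S" "S - Q \<subseteq> {1..m}" using QS psubset.prems by auto
      from psubset.IH[OF this] obtain \<Q> where \<Q>: "disjoint \<Q>" "\<Union>\<Q> \<subseteq> S - Q" "\<forall>Q\<in>\<Q>. card Q \<le> d + 1"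
        "f (S - Q) \<le> (real d + 1) * (\<Sum>Q\<in>\<Q>. f Q)"
        by (elim exE conjE)
      have "\<Q> \<subseteq> Pow S" using \<Q>(2) by auto
      then have fin: "finite \<Q>" using psubset.hyps finite_subset by blast
      have notin: "Q \<notin> \<Q>" using \<Q>(2) QS(2) by auto
      have "f ((S - Q) \<union> Q) \<le> f (S - Q) + real (card Q) * f Q"
      proof (rule setfun_growth_le[OF assms(1,2)])
        fix Q' assume Q': "Q' \<subseteq> S - Q \<union> Q" "card Q' \<le> d + 1"
        show "f Q' \<le> f Q"
        proof (cases "Q' = {}")
          case True
          then show ?thesis using assms(1) fQ by (simp add: valuation_def)
        next
          case False
          then show ?thesis using Q' QS by (intro max) (auto simp: C_def)
        qed
      qed (use QS psubset.prems in auto)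
      also have "(S - Q) \<union> Q = S" using QS by auto
      \<comment> \<open>The approximation factor arises here: at most \<open>d + 1\<close> items
        return, each contributing at most \<open>f Q\<close>.\<close>
      also have "f (S - Q) + real (card Q) * f Q \<le> f (S - Q) + (real d + 1) * f Q"
        using QS(3) fQ by (intro add_left_mono mult_right_mono) linarith+
      finally have "f S \<le> (real d + 1) * (\<Sum>Q\<in>insert Q \<Q>. f Q)"
        using \<Q>(4) fin notin by (simp add: algebra_simps)
      moreover have "disjoint (insert Q \<Q>)"
        using \<Q>(1,2) by (auto simp: disjoint_def)
      moreover have "\<Union>(insert Q \<Q>) \<subseteq> S" "\<forall>Q\<in>insert Q \<Q>. card Q \<le> d + 1"
        using \<Q>(2,3) QS by auto
      ultimately show ?thesis by blast
    qed
  qed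
  then show ?thesis by (elim exE conjE) (rule that)
qed

lemma superadditive_blocks:
  assumes "valuation m f" "f \<in> SUPADD m" "finite \<Q>" "disjoint \<Q>" "\<Union>\<Q> \<subseteq> T" "T \<subseteq> {1..m}"
  shows "(\<Sum>Q\<in>\<Q>. f Q) \<le> f T"
proof -
  have "(\<Sum>Q\<in>\<Q>. f Q) \<le> f (\<Union>\<Q>)" using assms(3-5)
  proof (induction \<Q> rule: finite_induct)
    case empty
    then show ?case using assms(1) by (simp add: valuation_def)
  next
    case (insert Q \<Q>)
    have "Q \<inter> \<Union>\<Q> = {}" using insert.prems insert.hyps by (auto simp: disjoint_def)
    moreover have "Q \<subseteq> {1..m}" "\<Union>\<Q> \<subseteq> {1..m}" using insert.prems(2) assms(6) by auto
    ultimately have "f Q + f (\<Union>\<Q>) \<le> f (Q \<union> \<Union>\<Q>)"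
      using assms(2) unfolding SUPADD_def by auto
    moreover have "(\<Sum>Q\<in>\<Q>. f Q) \<le> f (\<Union>\<Q>)"
      using insert.prems by (intro insert.IH) (auto simp: disjoint_def)
    ultimately show ?case using insert.hyps by simp
  qed
  also have "\<dots> \<le> f T"
    using assms(1,5,6) unfolding valuation_def monotone_setfun_def by blast
  finally show ?thesis .
qed

section \<open>Pointwise maxima\<close>

lemma valuation_max_class:
  assumes "f \<in> max_class m \<F>" "\<And>g. g \<in> \<F> \<Longrightarrow> valuation m g"
  shows "valuation m f"
proof -
  obtain k :: nat and g where k: "1 \<le> k" and g: "\<And>i. i \<in> {1..k} \<Longrightarrow> g i \<in> \<F>"
    and f: "\<And>S. S \<subseteq> {1..m} \<Longrightarrow> f S = Max ((\<lambda>i. g i S) ` {1..k})"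
    using assms(1) unfolding max_class_def by blast
  have val: "valuation m (g i)" if "i \<in> {1..k}" for i using assms(2) g that by blast
  have ge: "g i S \<le> f S" if "i \<in> {1..k}" "S \<subseteq> {1..m}" for i S
    using that f by (auto intro!: Max_ge)
  have in_img: "\<exists>i\<in>{1..k}. f S = g i S" if "S \<subseteq> {1..m}" for S
  proof -
    have "f S \<in> (\<lambda>i. g i S) ` {1..k}" unfolding f[OF that] using k by (intro Max_in) auto
    then show ?thesis by auto
  qed
  show ?thesis unfolding valuation_def monotone_setfun_def
  proof (intro conjI allI impI)
    show "f {} = 0" using in_img[of "{}"] val by (auto simp: valuation_def)
    fix S T :: "nat set"
    show "0 \<le> f S" if "S \<subseteq> {1..m}"
      using in_img[OF that] val that by (auto simp: valuation_def)
    assume ST: "S \<subseteq> T \<and> T \<subseteq> {1..m}"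
    then obtain i where i: "i \<in> {1..k}" "f S = g i S" using in_img[of S] by (meson subset_trans)
    note i(2)
    also have "g i S \<le> g i T"
      using val[OF i(1)] ST unfolding valuation_def monotone_setfun_def by blast
    also have "\<dots> \<le> f T" using ge i ST by blast
    finally show "f S \<le> f T" .
  qed
qed

text \<open>A clause attaining the maximum at \<open>S\<close> lies below \<open>f\<close>
  everywhere. It acts as a supporting function, as additive clauses do for XOS valuations.\<close>

lemma max_class_supporting:
  assumes "f \<in> max_class m \<F>" "S \<subseteq> {1..m}"
  obtains g where "g \<in> \<F>" "g S = f S" "\<forall>T. T \<subseteq> {1..m} \<longrightarrow> g T \<le> f T"
proof -
  obtain k :: nat and g where k: "1 \<le> k" and g: "\<And>i. i \<in> {1..k} \<Longrightarrow> g i \<in> \<F>"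
    and f: "\<And>S. S \<subseteq> {1..m} \<Longrightarrow> f S = Max ((\<lambda>i. g i S) ` {1..k})"
    using assms(1) unfolding max_class_def by blast
  have "f S \<in> (\<lambda>i. g i S) ` {1..k}" unfolding f[OF assms(2)] using k by (intro Max_in) auto
  then obtain i where i: "i \<in> {1..k}" "f S = g i S" by auto
  have "g i T \<le> f T" if "T \<subseteq> {1..m}" for T using f[OF that] i by (auto intro!: Max_ge)
  then show ?thesis using that[OF g[OF i(1)]] i(2) by simp
qed

text \<open>The weights \<open>q\<close> are the block values under the clause supporting
  \<open>f\<close> at \<open>S\<close>. Superadditivity is known for that clause, whereas the
  maximum \<open>f\<close> may fail to be superadditive; domination by \<open>f\<close> then carries
  the lower bound over.\<close>

lemma max_class_packing:
  assumes "f \<in> max_class m (SMW_class m d \<inter> SUPADD m)" "S \<subseteq> {1..m}"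
  obtains \<Q> q where "finite \<Q>" "disjoint \<Q>" "\<Union>\<Q> \<subseteq> S" "\<forall>Q\<in>\<Q>. card Q \<le> d + 1"
    "\<forall>Q\<in>\<Q>. 0 \<le> q Q" "f S \<le> (real d + 1) * (\<Sum>Q\<in>\<Q>. q Q)"
    "\<forall>T. T \<subseteq> {1..m} \<longrightarrow> (\<Sum>Q\<in>{Q\<in>\<Q>. Q \<subseteq> T}. q Q) \<le> f T"
proof -
  obtain g where "g \<in> SMW_class m d \<inter> SUPADD m" and eq: "g S = f S"
    and le: "\<forall>T. T \<subseteq> {1..m} \<longrightarrow> g T \<le> f T"
    by (rule max_class_supporting[OF assms])
  then have g: "valuation m g" "SMW m g \<le> d" "g \<in> SUPADD m" by (auto simp: SMW_class_def)
  obtain \<Q> where \<Q>: "disjoint \<Q>" "\<Union>\<Q> \<subseteq> S" "\<forall>Q\<in>\<Q>. card Q \<le> d + 1"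
    "g S \<le> (real d + 1) * (\<Sum>Q\<in>\<Q>. g Q)"
    using packing_exists[OF g(1,2) assms(2)] by blast
  have sub: "\<Q> \<subseteq> Pow {1..m}" using \<Q>(2) assms(2) by auto
  then have fin: "finite \<Q>" using finite_subset by blast
  have below: "\<forall>T. T \<subseteq> {1..m} \<longrightarrow> (\<Sum>Q\<in>{Q\<in>\<Q>. Q \<subseteq> T}. g Q) \<le> f T"
  proof (intro allI impI)
    fix T assume T: "T \<subseteq> {1..m}"
    have "(\<Sum>Q\<in>{Q\<in>\<Q>. Q \<subseteq> T}. g Q) \<le> g T"
      using fin \<Q>(1) T by (intro superadditive_blocks[OF g(1,3)]) (auto simp: disjoint_def)
    also have "g T \<le> f T" using le T by blast
    finally show "(\<Sum>Q\<in>{Q\<in>\<Q>. Q \<subseteq> T}. g Q) \<le> f T" .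
  qed
  have "\<forall>Q\<in>\<Q>. 0 \<le> g Q" using g(1) sub unfolding valuation_def by blast
  then show ?thesis by (rule that[OF fin \<Q>(1-3) _ \<Q>(4)[unfolded eq] below])
qed

section \<open>Averaging over a random block price\<close>

text \<open>Discretised form of the smoothness inequality for one block: a price drawn uniformly from
  \<open>[0, q / k]\<close> exceeds \<open>x\<close> with probability at least \<open>1 - k x / q\<close> and costs \<open>q / 2\<close> on average.\<close>

lemma uniform_price_average:
  fixes q k x :: real and N :: nat
  assumes "0 \<le> q" "0 < k" "0 \<le> x" "0 < N"
  shows "q / 2 - k * x - q / (2 * real N) \<le>
    (\<Sum>s\<in>{1..N}. (if x < real s * q / (k * real N) then q else 0) - real s * q / real N) / real N"
proof -
  have gauss: "(\<Sum>s\<in>{1..N}. real s) = real N * (real N + 1) / 2"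
    by (induction N) (auto simp: field_simps)
  have "(\<Sum>s\<in>{1..N}. real s * q / real N) = (\<Sum>s\<in>{1..N}. real s) * q / real N"
    by (simp add: sum_distrib_right sum_divide_distrib)
  then have cost: "(\<Sum>s\<in>{1..N}. real s * q / real N) = (real N + 1) * q / 2"
    unfolding gauss using assms(4) by simp
  have gain: "real N * (q - k * x) \<le> (\<Sum>s\<in>{1..N}. if x < real s * q / (k * real N) then q else 0)"
  proof (cases "q = 0")
    case True
    then show ?thesis using assms by simp
  next
    case False
    then have q: "0 < q" using assms(1) by simp
    \<comment> \<open>\<open>y\<close> is the real grid index at which the price equals
      \<open>x\<close>. The losing prices are those with index at most \<open>y\<close>, and there
      are at most \<open>y\<close> of them.\<close>
    define y where "y = x * k * real N / q"
    have y: "0 \<le> y" using assms q by (simp add: y_def)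
    have iff: "x < real s * q / (k * real N) \<longleftrightarrow> \<not> real s \<le> y" for s
      unfolding y_def using assms q by (simp add: field_simps not_le)
    have "{s\<in>{1..N}. real s \<le> y} \<subseteq> {1..nat \<lfloor>y\<rfloor>}" by (auto simp: le_nat_floor)
    then have "card {s\<in>{1..N}. real s \<le> y} \<le> nat \<lfloor>y\<rfloor>"
      using card_mono[of "{1..nat \<lfloor>y\<rfloor>}"] by simp
    then have low: "real (card {s\<in>{1..N}. real s \<le> y}) \<le> y" using y by linarith
    have "(\<Sum>s\<in>{1..N}. if x < real s * q / (k * real N) then q else 0)
        = (\<Sum>s\<in>{1..N}. q - (if real s \<le> y then q else 0))"
      by (intro sum.cong) (auto simp: iff)
    also have "\<dots> = real N * q - real (card {s\<in>{1..N}. real s \<le> y}) * q"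
      by (simp add: sum_subtractf sum.If_cases Int_def)
    also have "\<dots> \<ge> real N * q - y * q" using low q by simp
    also have "real N * q - y * q = real N * (q - k * x)"
      using q by (simp add: y_def algebra_simps)
    finally show ?thesis .
  qed
  \<comment> \<open>The grid costs sum to \<open>(N + 1) * q / 2\<close> instead of
    \<open>N * q / 2\<close>; after division by \<open>N\<close> this excess is the error
    \<open>q / (2 * N)\<close>.\<close>
  have "(q / 2 - k * x - q / (2 * real N)) * real N = real N * (q - k * x) - (real N + 1) * q / 2"
    using assms(4) by (simp add: field_simps)
  also have "\<dots> \<le> (\<Sum>s\<in>{1..N}. (if x < real s * q / (k * real N) then q else 0) - real s * q / real N)"
    using gain cost by (simp add: sum_subtractf)
  finally show ?thesis using assms(4) by (simp add: pos_le_divide_eq)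
qed

section \<open>Winners, revenue and integrability in the auction\<close>

text \<open>All bidders are included, even one who is about to deviate. The top bids therefore add
  up to the exact revenue, and beating them certainly beats every rival.\<close>

definition top_bid :: "nat \<Rightarrow> (nat \<Rightarrow> nat \<Rightarrow> real) \<Rightarrow> nat \<Rightarrow> real" where
  "top_bid n b j = Max ((\<lambda>i. b i j) ` {1..n})"

lemma bid_le_top_bid: "i \<in> {1..n} \<Longrightarrow> b i j \<le> top_bid n b j"
  unfolding top_bid_def by (intro Max_ge) auto

lemma profile_space_nonneg:
  assumes "b \<in> space (profile_space n m)" "i \<in> {1..n}" "j \<in> {1..m}"
  shows "0 \<le> b i j"
proof -
  have "b i \<in> space (bid_space m)"
    using assms(1,2) unfolding profile_space_def space_PiM by (rule PiE_mem)
  then have "b i j \<in> space (restrict_space borel {0::real..})"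
    using assms(3) unfolding bid_space_def space_PiM by (rule PiE_mem)
  then show ?thesis by (simp add: space_restrict_space)
qed

lemma measurable_deviation:
  assumes "i \<in> {1..n}" "b' \<in> space (bid_space m)"
  shows "(\<lambda>b. b(i := b')) \<in> measurable (profile_space n m) (profile_space n m)"
  unfolding profile_space_def
proof (rule measurable_fun_upd)
  show "{1..n} = {1..n} \<union> {i}" using assms(1) by auto
qed (use assms in auto)

lemma winner_highest:
  assumes "first_price_rule n m A" "b \<in> space (profile_space n m)" "w \<in> set_pmf (A b)"
  shows "w \<in> (\<Pi>\<^sub>E j\<in>{1..m}. {1..n})"
    and "i \<in> {1..n} \<Longrightarrow> j \<in> {1..m} \<Longrightarrow> b i j \<le> b (w j) j"
proof -
  have w: "w \<in> (\<Pi>\<^sub>E j\<in>{1..m}. highest_bidders n b j)"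
    using assms unfolding first_price_rule_def by blast
  then show "w \<in> (\<Pi>\<^sub>E j\<in>{1..m}. {1..n})" by (auto simp: highest_bidders_def PiE_iff)
  show "b i j \<le> b (w j) j" if "i \<in> {1..n}" "j \<in> {1..m}"
    using PiE_mem[OF w that(2)] that(1) by (auto simp: highest_bidders_def)
qed

lemma winner_top_bid:
  assumes "first_price_rule n m A" "b \<in> space (profile_space n m)" "w \<in> set_pmf (A b)" "j \<in> {1..m}"
  shows "top_bid n b j = b (w j) j"
  unfolding top_bid_def
proof (rule Max_eqI)
  have "w j \<in> {1..n}" using winner_highest(1)[OF assms(1-3)] assms(4) by (rule PiE_mem)
  then show "b (w j) j \<in> (\<lambda>i. b i j) ` {1..n}" by blast
qed (use winner_highest(2)[OF assms(1-3) _ assms(4)] in auto)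

lemma top_bid_nonneg:
  assumes "first_price_rule n m A" "b \<in> space (profile_space n m)" "j \<in> {1..m}"
  shows "0 \<le> top_bid n b j"
proof -
  \<comment> \<open>An allocation in the support exhibits a winner of \<open>j\<close>, so there is
    at least one bidder and the \<open>Max\<close> in \<open>top_bid\<close> is over a nonempty
    set.\<close>
  obtain w where w: "w \<in> set_pmf (A b)" using set_pmf_not_empty[of "A b"] by blast
  have "w j \<in> {1..n}" using winner_highest(1)[OF assms(1,2) w] assms(3) by (rule PiE_mem)
  then show ?thesis
    using winner_top_bid[OF assms(1,2) w assms(3)] profile_space_nonneg[OF assms(2) _ assms(3)] by simp
qed

lemma finite_set_pmf_rule:
  assumes "first_price_rule n m A" "b \<in> space (profile_space n m)"
  shows "finite (set_pmf (A b))"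
proof (rule finite_subset)
  show "set_pmf (A b) \<subseteq> (\<Pi>\<^sub>E j\<in>{1..m}. {1..n})" using winner_highest(1)[OF assms] by blast
qed (auto intro: finite_PiE)

text \<open>Only finitely many allocations have positive probability, and each probability is
  measurable in the bids and bounded by 1. The map \<open>h\<close> is the identity for equilibrium
  welfare and \<open>b(i := b')\<close> for a deviation.\<close>

lemma integrable_expectation_rule:
  fixes g :: "(nat \<Rightarrow> nat) \<Rightarrow> real"
  assumes "first_price_rule n m A" "prob_space M" "h \<in> measurable M (profile_space n m)"
  shows "integrable M (\<lambda>b. measure_pmf.expectation (A (h b)) g)"
proof -
  let ?F = "\<Pi>\<^sub>E j\<in>{1..m}. {1..n}"
  have fin: "finite ?F" by (intro finite_PiE) auto
  have "measure_pmf.expectation (A (h b)) g = (\<Sum>w\<in>?F. g w * pmf (A (h b)) w)"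
    if "b \<in> space M" for b
    using winner_highest(1)[OF assms(1) measurable_space[OF assms(3) that]] fin
    by (intro integral_measure_pmf_real) auto
  moreover have "integrable M (\<lambda>b. \<Sum>w\<in>?F. g w * pmf (A (h b)) w)"
  proof (intro Bochner_Integration.integrable_sum integrable_mult_right)
    fix w
    have "(\<lambda>b. pmf (A b) w) \<in> borel_measurable (profile_space n m)"
      using assms(1) unfolding first_price_rule_def by blast
    from measurable_compose[OF assms(3) this]
    show "integrable M (\<lambda>b. pmf (A (h b)) w)"
      by (intro finite_measure.integrable_const_bound[of _ _ 1]
          prob_space.finite_measure[OF assms(2)]) (auto simp: pmf_le_1)
  qed
  ultimately show ?thesis by (simp cong: Bochner_Integration.integrable_cong)
qed

lemma won_sum:
  assumes "w \<in> (\<Pi>\<^sub>E j\<in>{1..m}. {1..n})"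
  shows "(\<Sum>i\<in>{1..n}. \<Sum>j\<in>won m w i. b i j) = (\<Sum>j\<in>{1..m}. b (w j) j)"
proof -
  have "(\<Sum>i\<in>{1..n}. \<Sum>j\<in>won m w i. b i j) = (\<Sum>i\<in>{1..n}. \<Sum>j\<in>{j\<in>{1..m}. w j = i}. b (w j) j)"
    by (intro sum.cong) (auto simp: won_def)
  also have "\<dots> = (\<Sum>j\<in>{1..m}. b (w j) j)"
    using assms by (intro sum.group) auto
  finally show ?thesis .
qed

text \<open>Payments are what separates welfare from utilities. Every supported winner of an item
  pays its top bid, so the revenue is the same for all tie-breaking outcomes.\<close>

lemma welfare_minus_utilities:
  assumes "first_price_rule n m A" "b \<in> space (profile_space n m)"
  shows "welfare n m A v b - (\<Sum>i\<in>{1..n}. utility m A v i b) = (\<Sum>j\<in>{1..m}. top_bid n b j)"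
proof -
  note [simp] = integrable_measure_pmf_finite[OF finite_set_pmf_rule[OF assms]]
  have "(\<Sum>i\<in>{1..n}. utility m A v i b) = measure_pmf.expectation (A b)
      (\<lambda>w. \<Sum>i\<in>{1..n}. v i (won m w i) - (\<Sum>j\<in>won m w i. b i j))"
    unfolding utility_def by simp
  also have "\<dots> = measure_pmf.expectation (A b)
      (\<lambda>w. (\<Sum>i\<in>{1..n}. v i (won m w i)) - (\<Sum>j\<in>{1..m}. top_bid n b j))"
  proof (rule integral_cong_AE)
    show "AE w in measure_pmf (A b). (\<Sum>i\<in>{1..n}. v i (won m w i) - (\<Sum>j\<in>won m w i. b i j))
        = (\<Sum>i\<in>{1..n}. v i (won m w i)) - (\<Sum>j\<in>{1..m}. top_bid n b j)"
      using won_sum[OF winner_highest(1)[OF assms]] winner_top_bid[OF assms]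
      by (auto simp: AE_measure_pmf_iff sum_subtractf)
  qed auto
  also have "\<dots> = welfare n m A v b - (\<Sum>j\<in>{1..m}. top_bid n b j)"
    unfolding welfare_def by (subst Bochner_Integration.integral_diff) auto
  finally show ?thesis by simp
qed

section \<open>Deviations and smoothness inequalities\<close>

text \<open>If the sum of the top bids on a block is below \<open>t Q\<close>, so is each of them,
  and the block is won as a whole. Comparing with the sum rather than the maximum lets the block
  conditions add up to revenue later. Payments are bounded as if every bid were paid.\<close>

lemma block_bid_utility:
  fixes t q :: "nat set \<Rightarrow> real" and k :: real
  assumes rule: "first_price_rule n m A" and i: "i \<in> {1..n}"
    and \<Q>: "finite \<Q>" "\<Union>\<Q> \<subseteq> {1..m}" "\<And>Q. Q \<in> \<Q> \<Longrightarrow> real (card Q) \<le> k"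
    and q: "\<And>Q. Q \<in> \<Q> \<Longrightarrow> 0 \<le> q Q" and t: "\<And>Q. Q \<in> \<Q> \<Longrightarrow> 0 \<le> t Q"
    and v: "\<And>T. T \<subseteq> {1..m} \<Longrightarrow> (\<Sum>Q\<in>{Q\<in>\<Q>. Q \<subseteq> T}. q Q) \<le> v i T"
  obtains b' where "b' \<in> space (bid_space m)"
    "\<forall>b\<in>space (profile_space n m).
      (\<Sum>Q\<in>\<Q>. (if (\<Sum>j\<in>Q. top_bid n b j) < t Q then q Q else 0) - k * t Q)
        \<le> utility m A v i (b(i := b'))"
proof -
  \<comment> \<open>For disjoint blocks this sum has at most one term: the price of the block
    containing \<open>j\<close>, and 0 outside all blocks.\<close>
  define b' where "b' = (\<lambda>j\<in>{1..m}. \<Sum>Q\<in>{Q\<in>\<Q>. j \<in> Q}. t Q)"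
  have b'_nonneg: "0 \<le> b' j" if "j \<in> {1..m}" for j
    using that t by (auto simp: b'_def intro: sum_nonneg)
  have b': "b' \<in> space (bid_space m)"
    unfolding bid_space_def space_PiM space_restrict_space
    using b'_nonneg by (auto simp: PiE_iff b'_def)
  have "(\<Sum>Q\<in>\<Q>. (if (\<Sum>j\<in>Q. top_bid n b j) < t Q then q Q else 0) - k * t Q)
      \<le> utility m A v i (b(i := b'))" if b: "b \<in> space (profile_space n m)" for b
  proof -
    let ?b = "b(i := b')"
    have space: "?b \<in> space (profile_space n m)"
      using measurable_space[OF measurable_deviation[OF i b'] b] .
    have "(\<Sum>Q\<in>\<Q>. (if (\<Sum>j\<in>Q. top_bid n b j) < t Q then q Q else 0) - k * t Q)
        \<le> v i (won m w i) - (\<Sum>j\<in>won m w i. ?b i j)" if w: "w \<in> set_pmf (A ?b)" for w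
    proof -
      have sub: "won m w i \<subseteq> {1..m}" by (auto simp: won_def)
      have wins: "Q \<subseteq> won m w i" if Q: "Q \<in> \<Q>" and less: "(\<Sum>j\<in>Q. top_bid n b j) < t Q" for Q
      proof
        fix j assume j: "j \<in> Q"
        have jm: "j \<in> {1..m}" and Qm: "Q \<subseteq> {1..m}" using j Q \<Q>(2) by auto
        have "t Q \<le> (\<Sum>Q\<in>{Q\<in>\<Q>. j \<in> Q}. t Q)"
          using Q j \<Q>(1) t by (intro member_le_sum) auto
        then have "t Q \<le> b' j" using jm by (simp add: b'_def)
        moreover have "top_bid n b j \<le> (\<Sum>j\<in>Q. top_bid n b j)"
          using j Qm top_bid_nonneg[OF rule b] finite_subset[OF Qm] by (intro member_le_sum) auto
        \<comment> \<open>Strictness matters: the deviator wins \<open>j\<close> without relying on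
          the tie-breaking.\<close>
        ultimately have high: "top_bid n b j < b' j" using less by simp
        have "w j \<in> {1..n}" using winner_highest(1)[OF rule space w] jm by (rule PiE_mem)
        moreover have "b' j \<le> ?b (w j) j" using winner_highest(2)[OF rule space w i jm] by simp
        ultimately have "w j = i"
          using bid_le_top_bid[of "w j" n b j] high by (cases "w j = i") auto
        then show "j \<in> won m w i" using jm by (simp add: won_def)
      qed
      have "(\<Sum>Q\<in>\<Q>. if (\<Sum>j\<in>Q. top_bid n b j) < t Q then q Q else 0)
          \<le> (\<Sum>Q\<in>\<Q>. if Q \<subseteq> won m w i then q Q else 0)"
        using wins q by (intro sum_mono) auto
      also have "\<dots> = (\<Sum>Q\<in>{Q\<in>\<Q>. Q \<subseteq> won m w i}. q Q)"
        using \<Q>(1) by (simp add: sum.inter_filter)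
      also have "\<dots> \<le> v i (won m w i)" using v[OF sub] .
      finally have gain: "(\<Sum>Q\<in>\<Q>. if (\<Sum>j\<in>Q. top_bid n b j) < t Q then q Q else 0)
          \<le> v i (won m w i)" .
      \<comment> \<open>Bids are nonnegative, so charging for all items overestimates the payment;
        exchanging the summation order then counts \<open>t Q\<close> once per item of
        \<open>Q\<close>.\<close>
      have "(\<Sum>j\<in>won m w i. b' j) \<le> (\<Sum>j\<in>{1..m}. b' j)"
        using sub b'_nonneg by (intro sum_mono2) auto
      also have "\<dots> = (\<Sum>j\<in>{1..m}. \<Sum>Q\<in>{Q\<in>\<Q>. j \<in> Q}. t Q)"
        by (simp add: b'_def)
      also have "\<dots> = (\<Sum>Q\<in>\<Q>. \<Sum>j\<in>{j\<in>{1..m}. j \<in> Q}. t Q)"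
        using \<Q>(1) by (intro sum.swap_restrict) auto
      also have "\<dots> = (\<Sum>Q\<in>\<Q>. real (card Q) * t Q)"
      proof (rule sum.cong)
        fix Q assume "Q \<in> \<Q>"
        then have "{j\<in>{1..m}. j \<in> Q} = Q" using \<Q>(2) by auto
        then show "(\<Sum>j\<in>{j\<in>{1..m}. j \<in> Q}. t Q) = real (card Q) * t Q" by simp
      qed simp
      also have "\<dots> \<le> (\<Sum>Q\<in>\<Q>. k * t Q)"
        using \<Q>(3) t by (intro sum_mono mult_right_mono) auto
      finally show ?thesis using gain by (simp add: sum_subtractf)
    qed
    then show ?thesis
      unfolding utility_def
      by (intro measure_pmf.integral_ge_const integrable_measure_pmf_finite
          finite_set_pmf_rule[OF rule space]) (auto simp: AE_measure_pmf_iff)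
  qed
  then show ?thesis by (intro that[OF b'] ballI)
qed

text \<open>Under the zero bid everything won, possibly through ties, is free. This is what bounds
  expected revenue by expected welfare.\<close>

lemma CCE_utility_nonneg:
  assumes M: "M \<in> coarse_correlated_equilibria n m A v"
    and i: "i \<in> {1..n}" and val: "valuation m (v i)"
  shows "0 \<le> (\<integral>b. utility m A v i b \<partial>M)"
proof -
  define z :: "nat \<Rightarrow> real" where "z = (\<lambda>j\<in>{1..m}. 0)"
  have z: "z \<in> space (bid_space m)"
    unfolding bid_space_def space_PiM space_restrict_space z_def by auto
  have "0 \<le> v i (won m w i) - (\<Sum>j\<in>won m w i. z j)" for w
  proof -
    have sub: "won m w i \<subseteq> {1..m}" by (auto simp: won_def)
    then have "0 \<le> v i (won m w i)" using val unfolding valuation_def by blast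
    moreover have "(\<Sum>j\<in>won m w i. z j) = 0"
      unfolding z_def using sub by (intro sum.neutral) auto
    ultimately show ?thesis by simp
  qed
  then have "0 \<le> (\<integral>b. utility m A v i (b(i := z)) \<partial>M)"
    unfolding utility_def fun_upd_same by (intro Bochner_Integration.integral_nonneg)
  also have "\<dots> \<le> (\<integral>b. utility m A v i b \<partial>M)"
    using M i z unfolding coarse_correlated_equilibria_def by blast
  finally show ?thesis .
qed

text \<open>The equilibrium condition concerns fixed deviations, so the uniform price is replaced by
  the average over \<open>N\<close> deterministic bid vectors \<open>dev s\<close>. These are chosen
  independently of \<open>b\<close>, so they are available to a bidder who does not see the
  recommended profile.\<close>

lemma bidder_smoothness:
  assumes rule: "first_price_rule n m A" and i: "i \<in> {1..n}"
    and v: "v i \<in> max_class m (SMW_class m d \<inter> SUPADD m)"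
    and S: "S \<subseteq> {1..m}" and N: "0 < N"
  obtains dev :: "nat \<Rightarrow> nat \<Rightarrow> real" where "\<And>s. dev s \<in> space (bid_space m)"
    "\<And>b. b \<in> space (profile_space n m) \<Longrightarrow>
       (1 / 2 - 1 / (2 * real N)) * (v i S / (real d + 1))
         - (real d + 1) * (\<Sum>j\<in>S. top_bid n b j)
       \<le> (\<Sum>s\<in>{1..N}. utility m A v i (b(i := dev s))) / real N"
proof -
  define k where "k = real d + 1"
  have k: "0 < k" by (simp add: k_def)
  obtain \<Q> q where fin: "finite \<Q>" and disj: "disjoint \<Q>"
    and sub: "\<Union>\<Q> \<subseteq> S" and card: "\<forall>Q\<in>\<Q>. card Q \<le> d + 1"
    and nonneg: "\<forall>Q\<in>\<Q>. 0 \<le> q Q" and approx: "v i S \<le> k * (\<Sum>Q\<in>\<Q>. q Q)"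
    and below: "\<forall>T. T \<subseteq> {1..m} \<longrightarrow> (\<Sum>Q\<in>{Q\<in>\<Q>. Q \<subseteq> T}. q Q) \<le> v i T"
    by (rule max_class_packing[OF v S, folded k_def])
  note q = bspec[OF nonneg] and below = mp[OF spec[OF below]]
  \<comment> \<open>An equally spaced grid on \<open>[0, q Q / k]\<close>. One index
    \<open>s\<close> sets the prices of all blocks; the correlation is harmless because only sums of
    averages enter.\<close>
  define t where "t s Q = real s * q Q / (k * real N)" for s :: nat and Q
  have sub': "\<Union>\<Q> \<subseteq> {1..m}" using sub S by blast
  have card': "real (card Q) \<le> k" if "Q \<in> \<Q>" for Q using bspec[OF card that] by (simp add: k_def)
  have t: "0 \<le> t s Q" if "Q \<in> \<Q>" for s Q using q[OF that] k by (simp add: t_def)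
  have "\<forall>s. \<exists>b'. b' \<in> space (bid_space m) \<and> (\<forall>b\<in>space (profile_space n m).
      (\<Sum>Q\<in>\<Q>. (if (\<Sum>j\<in>Q. top_bid n b j) < t s Q then q Q else 0) - k * t s Q)
        \<le> utility m A v i (b(i := b')))"
  proof
    fix s
    show "\<exists>b'. b' \<in> space (bid_space m) \<and> (\<forall>b\<in>space (profile_space n m).
      (\<Sum>Q\<in>\<Q>. (if (\<Sum>j\<in>Q. top_bid n b j) < t s Q then q Q else 0) - k * t s Q)
        \<le> utility m A v i (b(i := b')))"
      by (rule block_bid_utility[where v = v and t = "t s", OF rule i fin sub' card' q t below])
        blast+
  qed
  then obtain dev where dev: "\<And>s. dev s \<in> space (bid_space m)"
    "\<And>s b. b \<in> space (profile_space n m) \<Longrightarrow>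
      (\<Sum>Q\<in>\<Q>. (if (\<Sum>j\<in>Q. top_bid n b j) < t s Q then q Q else 0) - k * t s Q)
        \<le> utility m A v i (b(i := dev s))"
    unfolding choice_iff by blast
  have "(1 / 2 - 1 / (2 * real N)) * (v i S / k) - k * (\<Sum>j\<in>S. top_bid n b j)
       \<le> (\<Sum>s\<in>{1..N}. utility m A v i (b(i := dev s))) / real N"
    if b: "b \<in> space (profile_space n m)" for b
  proof -
    define x where "x Q = (\<Sum>j\<in>Q. top_bid n b j)" for Q
    have x: "0 \<le> x Q" if "Q \<in> \<Q>" for Q
      unfolding x_def using that sub' top_bid_nonneg[OF rule b] by (intro sum_nonneg) auto
    have finQ: "finite Q" if "Q \<in> \<Q>" for Q
      using that sub' finite_subset[of Q "{1..m}"] by blast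
    \<comment> \<open>Disjointness of the blocks ensures that each top bid is charged only
      once.\<close>
    have "(\<Sum>Q\<in>\<Q>. x Q) = (\<Sum>j\<in>\<Union>\<Q>. top_bid n b j)"
      unfolding x_def using disj finQ by (subst sum.Union_disjoint) (auto simp: disjoint_def)
    also have "\<dots> \<le> (\<Sum>j\<in>S. top_bid n b j)"
      using sub S top_bid_nonneg[OF rule b] finite_subset[OF S] by (intro sum_mono2) auto
    finally have xS: "(\<Sum>Q\<in>\<Q>. x Q) \<le> (\<Sum>j\<in>S. top_bid n b j)" .
    \<comment> \<open>The coefficient \<open>1 / 2 - 1 / (2 * real N)\<close> is nonnegative, so
      multiplying by it preserves the packing inequality.\<close>
    have "1 / (2 * real N) \<le> 1 / 2" using N by simp
    moreover have "v i S / k \<le> (\<Sum>Q\<in>\<Q>. q Q)" using approx k by (simp add: field_simps)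
    ultimately have "(1 / 2 - 1 / (2 * real N)) * (v i S / k) - k * (\<Sum>j\<in>S. top_bid n b j)
        \<le> (1 / 2 - 1 / (2 * real N)) * (\<Sum>Q\<in>\<Q>. q Q) - k * (\<Sum>Q\<in>\<Q>. x Q)"
      using xS k by (intro diff_mono mult_left_mono) auto
    also have "\<dots> = (\<Sum>Q\<in>\<Q>. q Q / 2 - k * x Q - q Q / (2 * real N))"
      by (simp add: sum_subtractf sum.distrib sum_distrib_left sum_divide_distrib algebra_simps)
    also have "\<dots> \<le> (\<Sum>Q\<in>\<Q>. (\<Sum>s\<in>{1..N}. (if x Q < t s Q then q Q else 0) - k * t s Q) / real N)"
    proof (rule sum_mono)
      fix Q assume Q: "Q \<in> \<Q>"
      have "k * t s Q = real s * q Q / real N" for s using k by (simp add: t_def)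
      then show "q Q / 2 - k * x Q - q Q / (2 * real N)
          \<le> (\<Sum>s\<in>{1..N}. (if x Q < t s Q then q Q else 0) - k * t s Q) / real N"
        using uniform_price_average[OF q[OF Q] k x[OF Q] N] by (simp add: t_def)
    qed
    also have "\<dots> = (\<Sum>s\<in>{1..N}. \<Sum>Q\<in>\<Q>. (if x Q < t s Q then q Q else 0) - k * t s Q) / real N"
      by (subst sum.swap) (simp add: sum_divide_distrib)
    also have "\<dots> \<le> (\<Sum>s\<in>{1..N}. utility m A v i (b(i := dev s))) / real N"
      using dev(2)[of b] b by (intro divide_right_mono sum_mono) (auto simp: x_def)
    finally show ?thesis .
  qed
  then show ?thesis using that[of dev] dev(1) unfolding k_def by blast
qed

lemma opt_welfare_attained:
  obtains X where "\<forall>i\<in>{1..n}. X i \<subseteq> {1..m}" "disjoint_family_on X {1..n}"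
    "opt_welfare n m v = (\<Sum>i\<in>{1..n}. v i (X i))"
proof -
  let ?D = "{X \<in> {1..n} \<rightarrow>\<^sub>E Pow {1..m}. disjoint_family_on X {1..n}}"
  have "finite ({1..n} \<rightarrow>\<^sub>E Pow {1..m})" by (intro finite_PiE) auto
  then have "finite ?D" by simp
  moreover have "(\<lambda>i\<in>{1..n}. {}) \<in> ?D" by (auto simp: disjoint_family_on_def)
  ultimately have "opt_welfare n m v \<in> (\<lambda>X. \<Sum>i\<in>{1..n}. v i (X i)) ` ?D"
    unfolding opt_welfare_def by (intro Max_in) blast+
  then obtain X where "X \<in> ?D" "opt_welfare n m v = (\<Sum>i\<in>{1..n}. v i (X i))" by blast
  then show ?thesis using that[of X] by (auto simp: PiE_iff)
qed

text \<open>Each bidder targets its bundle in a fixed optimal allocation. Disjoint bundles make the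
  bidders' top-bid terms sum to at most the revenue, which is expressed as welfare minus utilities
  so that its integrability follows from theirs.\<close>

lemma auction_smoothness:
  assumes rule: "first_price_rule n m A"
    and v: "\<And>i. i \<in> {1..n} \<Longrightarrow> v i \<in> max_class m (SMW_class m d \<inter> SUPADD m)"
    and N: "0 < N"
  obtains dev :: "nat \<Rightarrow> nat \<Rightarrow> nat \<Rightarrow> real"
  where "\<And>i s. i \<in> {1..n} \<Longrightarrow> dev i s \<in> space (bid_space m)"
    "\<And>b. b \<in> space (profile_space n m) \<Longrightarrow>
       (1 / 2 - 1 / (2 * real N)) * (opt_welfare n m v / (real d + 1))
         - (real d + 1) * (welfare n m A v b - (\<Sum>i\<in>{1..n}. utility m A v i b))
       \<le> (\<Sum>i\<in>{1..n}. (\<Sum>s\<in>{1..N}. utility m A v i (b(i := dev i s))) / real N)"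
proof -
  define k where "k = real d + 1"
  have k: "1 \<le> k" by (simp add: k_def)
  obtain X where sub: "\<forall>i\<in>{1..n}. X i \<subseteq> {1..m}" and disj: "disjoint_family_on X {1..n}"
    and opt: "opt_welfare n m v = (\<Sum>i\<in>{1..n}. v i (X i))"
    by (rule opt_welfare_attained)
  note X = bspec[OF sub] disj
  let ?c = "1 / 2 - 1 / (2 * real N)"
  have "\<forall>i\<in>{1..n}. \<exists>dev. (\<forall>s::nat. dev s \<in> space (bid_space m)) \<and>
    (\<forall>b\<in>space (profile_space n m). ?c * (v i (X i) / k) - k * (\<Sum>j\<in>X i. top_bid n b j)
       \<le> (\<Sum>s\<in>{1..N}. utility m A v i (b(i := dev s))) / real N)"
  proof
    fix i assume i: "i \<in> {1..n}"
    show "\<exists>dev. (\<forall>s::nat. dev s \<in> space (bid_space m)) \<and>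
      (\<forall>b\<in>space (profile_space n m). ?c * (v i (X i) / k) - k * (\<Sum>j\<in>X i. top_bid n b j)
        \<le> (\<Sum>s\<in>{1..N}. utility m A v i (b(i := dev s))) / real N)"
      by (rule bidder_smoothness[where v = v, OF rule i v[OF i] X(1)[OF i] N, folded k_def]) blast
  qed
  then obtain dev where dev: "\<And>i s. i \<in> {1..n} \<Longrightarrow> dev i s \<in> space (bid_space m)"
    and smooth: "\<And>i b. i \<in> {1..n} \<Longrightarrow> b \<in> space (profile_space n m) \<Longrightarrow>
      ?c * (v i (X i) / k) - k * (\<Sum>j\<in>X i. top_bid n b j)
       \<le> (\<Sum>s\<in>{1..N}. utility m A v i (b(i := dev i (s::nat)))) / real N"
    unfolding bchoice_iff by blast
  have "?c * (opt_welfare n m v / k) - k * (welfare n m A v b - (\<Sum>i\<in>{1..n}. utility m A v i b))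
      \<le> (\<Sum>i\<in>{1..n}. (\<Sum>s\<in>{1..N}. utility m A v i (b(i := dev i s))) / real N)"
    if b: "b \<in> space (profile_space n m)" for b
  proof -
    have "(\<Sum>i\<in>{1..n}. \<Sum>j\<in>X i. top_bid n b j) = (\<Sum>j\<in>(\<Union>i\<in>{1..n}. X i). top_bid n b j)"
      using X finite_subset[OF X(1)]
      by (intro sum.UNION_disjoint[symmetric]) (auto simp: disjoint_family_on_def)
    also have "\<dots> \<le> (\<Sum>j\<in>{1..m}. top_bid n b j)"
    proof (rule sum_mono2)
      show "(\<Union>i\<in>{1..n}. X i) \<subseteq> {1..m}" using X(1) by blast
    qed (use top_bid_nonneg[OF rule b] in auto)
    finally have "k * (\<Sum>i\<in>{1..n}. \<Sum>j\<in>X i. top_bid n b j)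
        \<le> k * (welfare n m A v b - (\<Sum>i\<in>{1..n}. utility m A v i b))"
      using k unfolding welfare_minus_utilities[OF rule b] by (intro mult_left_mono) auto
    moreover have "?c * (opt_welfare n m v / k) - k * (\<Sum>i\<in>{1..n}. \<Sum>j\<in>X i. top_bid n b j)
        = (\<Sum>i\<in>{1..n}. ?c * (v i (X i) / k) - k * (\<Sum>j\<in>X i. top_bid n b j))"
      by (simp only: opt sum_subtractf sum_distrib_left sum_divide_distrib)
    moreover have "\<dots> \<le> (\<Sum>i\<in>{1..n}. (\<Sum>s\<in>{1..N}. utility m A v i (b(i := dev i s))) / real N)"
      using smooth[OF _ b] by (rule sum_mono)
    ultimately show ?thesis by linarith
  qed
  then show ?thesis using that[of dev] dev unfolding k_def by blast
qed

section \<open>Expected welfare in equilibrium and the price of anarchy\<close>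

text \<open>\<open>R\<close> is the expected revenue.\<close>

lemma CCE_revenue_bound:
  assumes rule: "first_price_rule n m A"
    and v: "\<And>i. i \<in> {1..n} \<Longrightarrow> v i \<in> max_class m (SMW_class m d \<inter> SUPADD m)"
    and M: "M \<in> coarse_correlated_equilibria n m A v"
  obtains R where "R \<le> (\<integral>b. welfare n m A v b \<partial>M)"
    "opt_welfare n m v / (2 * (real d + 1)) \<le> (\<integral>b. welfare n m A v b \<partial>M) + real d * R"
proof -
  define k where "k = real d + 1"
  have k: "1 \<le> k" by (simp add: k_def)
  define W where "W = (\<integral>b. welfare n m A v b \<partial>M)"
  define U where "U i = (\<integral>b. utility m A v i b \<partial>M)" for i
  have P: "prob_space M" and sets: "sets M = sets (profile_space n m)"
    and int: "\<And>i. i \<in> {1..n} \<Longrightarrow> integrable M (utility m A v i)"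
    and eq: "\<And>i b'. i \<in> {1..n} \<Longrightarrow> b' \<in> space (bid_space m) \<Longrightarrow>
      (\<integral>b. utility m A v i (b(i := b')) \<partial>M) \<le> U i"
    using M unfolding coarse_correlated_equilibria_def U_def by auto
  have const: "integrable M (\<lambda>_. c)" for c :: real
    using P by (intro finite_measure.integrable_const prob_space.finite_measure)
  have space: "space M = space (profile_space n m)" using sets by (rule sets_eq_imp_space_eq)
  have meas: "f \<in> measurable M (profile_space n m)"
    if "f \<in> measurable (profile_space n m) (profile_space n m)" for f
    using that sets measurable_cong_sets by blast
  have int_W: "integrable M (welfare n m A v)"
    unfolding welfare_def by (rule integrable_expectation_rule[OF rule P meas]) auto
  have int_sum: "integrable M (\<lambda>b. \<Sum>i\<in>{1..n}. utility m A v i b)"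
    using int by (rule Bochner_Integration.integrable_sum)
  have int_R: "integrable M (\<lambda>b. welfare n m A v b - (\<Sum>i\<in>{1..n}. utility m A v i b))"
    using int_W int_sum by (rule Bochner_Integration.integrable_diff)
  have integral_R: "(\<integral>b. welfare n m A v b - (\<Sum>i\<in>{1..n}. utility m A v i b) \<partial>M)
      = W - (\<Sum>i\<in>{1..n}. U i)"
    unfolding W_def U_def Bochner_Integration.integral_diff[OF int_W int_sum]
    using int by (simp add: Bochner_Integration.integral_sum)
  have int_dev: "integrable M (\<lambda>b. utility m A v i (b(i := b')))"
    if "i \<in> {1..n}" "b' \<in> space (bid_space m)" for i b'
    unfolding utility_def fun_upd_same
    using integrable_expectation_rule[OF rule P meas[OF measurable_deviation[OF that]]] .
  have U_nonneg: "0 \<le> U i" if i: "i \<in> {1..n}" for i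
  proof -
    have "valuation m (v i)"
      using v[OF i] by (rule valuation_max_class) (simp add: SMW_class_def)
    then show ?thesis unfolding U_def by (rule CCE_utility_nonneg[OF M i])
  qed
  define R where "R = W - (\<Sum>i\<in>{1..n}. U i)"
  have "0 \<le> (\<Sum>i\<in>{1..n}. U i)" using U_nonneg by (rule sum_nonneg)
  then have RW: "R \<le> W" by (simp add: R_def)
  \<comment> \<open>Smoothness and the equilibrium condition bound the left side minus
    \<open>k * R\<close> by the total utility \<open>W - R\<close>. Since \<open>k = d + 1\<close>,
    moving \<open>k * R\<close> across leaves \<open>real d * R\<close>.\<close>
  have approx: "(1 / 2 - 1 / (2 * real N)) * (opt_welfare n m v / k) \<le> W + real d * R" if N: "0 < N" for N :: nat
  proof -
    let ?c = "1 / 2 - 1 / (2 * real N)"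
    show ?thesis
    proof (rule auction_smoothness[where v = v, OF rule v N, folded k_def space])
      fix dev :: "nat \<Rightarrow> nat \<Rightarrow> nat \<Rightarrow> real"
      assume dev: "\<And>i s. i \<in> {1..n} \<Longrightarrow> dev i s \<in> space (bid_space m)"
        and smooth: "\<And>b. b \<in> space M \<Longrightarrow> ?c * (opt_welfare n m v / k)
            - k * (welfare n m A v b - (\<Sum>i\<in>{1..n}. utility m A v i b))
          \<le> (\<Sum>i\<in>{1..n}. (\<Sum>s\<in>{1..N}. utility m A v i (b(i := dev i s))) / real N)"
      have "(\<integral>b. ?c * (opt_welfare n m v / k)
            - k * (welfare n m A v b - (\<Sum>i\<in>{1..n}. utility m A v i b)) \<partial>M)
          \<le> (\<integral>b. (\<Sum>i\<in>{1..n}. (\<Sum>s\<in>{1..N}. utility m A v i (b(i := dev i s))) / real N) \<partial>M)"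
      proof (rule integral_mono)
        show "integrable M (\<lambda>b. ?c * (opt_welfare n m v / k)
            - k * (welfare n m A v b - (\<Sum>i\<in>{1..n}. utility m A v i b)))"
          by (intro Bochner_Integration.integrable_diff[OF const] integrable_mult_right int_R)
        show "integrable M
            (\<lambda>b. \<Sum>i\<in>{1..n}. (\<Sum>s\<in>{1..N}. utility m A v i (b(i := dev i s))) / real N)"
          by (intro Bochner_Integration.integrable_sum integrable_divide_zero int_dev dev)
      qed (rule smooth)
      also have "\<dots> = (\<Sum>i\<in>{1..n}. (\<Sum>s\<in>{1..N}. \<integral>b. utility m A v i (b(i := dev i s)) \<partial>M) / real N)"
        using int_dev dev by (simp add: Bochner_Integration.integral_sum)
      also have "\<dots> \<le> (\<Sum>i\<in>{1..n}. (\<Sum>s\<in>{1..N}. U i) / real N)"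
        using eq dev by (intro sum_mono divide_right_mono) auto
      also have "\<dots> = (\<Sum>i\<in>{1..n}. U i)" using N by simp
      also have "(\<integral>b. ?c * (opt_welfare n m v / k)
            - k * (welfare n m A v b - (\<Sum>i\<in>{1..n}. utility m A v i b)) \<partial>M)
          = ?c * (opt_welfare n m v / k) - k * (W - (\<Sum>i\<in>{1..n}. U i))"
        using int_R integral_R by (simp add: prob_space.prob_space[OF P] const)
      finally show "?c * (opt_welfare n m v / k) \<le> W + real d * R"
        by (simp add: R_def k_def algebra_simps)
    qed
  qed
  \<comment> \<open>Letting \<open>N\<close> tend to infinity removes the discretisation error and
    recovers the constant \<open>1 / 2\<close> of the uniform price.\<close>
  have "(\<lambda>N. (1 / 2 - 1 / 2 * (1 / real N)) * (opt_welfare n m v / k))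
      \<longlonglongrightarrow> (1 / 2 - 1 / 2 * 0) * (opt_welfare n m v / k)"
    by (intro tendsto_intros lim_1_over_n)
  moreover have "(1 / 2 - 1 / 2 * (1 / real N)) * (opt_welfare n m v / k) \<le> W + real d * R" if "1 \<le> N" for N
    using approx[of N] that by simp
  ultimately have "(1 / 2 - 1 / 2 * 0) * (opt_welfare n m v / k) \<le> W + real d * R"
    by (intro LIMSEQ_le_const2) auto
  then show ?thesis using that[OF RW[unfolded W_def]] by (simp add: k_def W_def)
qed

theorem theorem19:
  fixes n m d :: nat
    and A :: "(nat \<Rightarrow> nat \<Rightarrow> real) \<Rightarrow> (nat \<Rightarrow> nat) pmf"
  assumes "d < m"
    and "first_price_rule n m A"
  shows "price_of_anarchy_CCE n m A (max_class m (SMW_class m d \<inter> SUPADD m))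
           \<le> ennreal (2 * (real d + 1)\<^sup>2 * H (real m / (real d + 1)))"
  unfolding price_of_anarchy_CCE_def
proof (rule Sup_least, safe)
  fix v M
  assume v: "\<forall>i\<in>{1..n}. v i \<in> max_class m (SMW_class m d \<inter> SUPADD m)"
    and M: "M \<in> coarse_correlated_equilibria n m A v"
  let ?c = "2 * (real d + 1)\<^sup>2" and ?h = "H (real m / (real d + 1))"
  let ?W = "\<integral>b. welfare n m A v b \<partial>M"
  obtain R where "R \<le> ?W" and opt: "opt_welfare n m v / (2 * (real d + 1)) \<le> ?W + real d * R"
    by (rule CCE_revenue_bound[where v = v, OF assms(2) bspec[OF v] M])
  \<comment> \<open>Replacing \<open>R\<close> by \<open>?W\<close> produces the second factor
    \<open>d + 1\<close> of the bound.\<close>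
  have "?W + real d * R \<le> ?W + real d * ?W"
    using \<open>R \<le> ?W\<close> by (intro add_left_mono mult_left_mono of_nat_0_le_iff)
  then have "?W + real d * R \<le> (real d + 1) * ?W" by (simp only: distrib_right mult_1 add.commute)
  then have "opt_welfare n m v \<le> (real d + 1) * ?W * (2 * (real d + 1))"
    using opt by (simp add: pos_divide_le_eq[symmetric])
  then have bound: "opt_welfare n m v \<le> ?c * ?W" by (simp only: power2_eq_square mult_ac)
  \<comment> \<open>\<open>d < m\<close> puts the index 1 into the range of the harmonic sum, and
    this single term already gives \<open>1 <= ?h\<close>.\<close>
  have m: "1 \<le> real m / (real d + 1)" using assms(1) by (simp add: pos_le_divide_eq)
  have "(\<Sum>k\<in>{1::int}. 1 / real_of_int k) \<le> ?h"
    unfolding H_def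
  proof (rule sum_mono2)
    have "{k::int. 1 \<le> k \<and> real_of_int k \<le> real m / (real d + 1)}
        \<subseteq> {1..\<lfloor>real m / (real d + 1)\<rfloor>}" by (auto simp: le_floor_iff)
    then show "finite {k::int. 1 \<le> k \<and> real_of_int k \<le> real m / (real d + 1)}"
      by (rule finite_subset) simp
  qed (use m in auto)
  then have "1 \<le> ?h" by simp
  then have "?c \<le> ?c * ?h" by simp
  show "ennreal (opt_welfare n m v) / ennreal ?W \<le> ennreal (?c * ?h)"
  proof (cases "0 < ?W")
    case True
    have "ennreal (opt_welfare n m v) / ennreal ?W \<le> ennreal (?c * ?W) / ennreal ?W"
      using bound by (intro divide_right_mono_ennreal ennreal_leI)
    also have "\<dots> = ennreal ?c" using True by (simp add: divide_ennreal)
    also have "\<dots> \<le> ennreal (?c * ?h)" using \<open>?c \<le> ?c * ?h\<close> by (rule ennreal_leI)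
    finally show ?thesis .
  next
    case False
    \<comment> \<open>With nonpositive expected welfare the denominator is 0 in
      \<open>ennreal\<close>. The bound forces the numerator to be 0 as well, so the quotient is 0
      rather than infinite.\<close>
    then have "?c * ?W \<le> 0" by (intro mult_nonneg_nonpos) auto
    then have "opt_welfare n m v \<le> 0" using bound by linarith
    then have "ennreal (opt_welfare n m v) = 0" by (rule ennreal_neg)
    then show ?thesis by simp
  qed
qed

end
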